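(* Let $\mathbb{K}$ be a field of characteristic zero and consider the invariant ring over digraphs $\overrightarrow{\mathcal{I}}_3$ on $n=3$ vertices. The two invariants $\mathcal{O}(\mathbf g_1)$ and $\mathcal{O}(\mathbf g_2)$, where $x^{\mathbf g_1}=x_{1,2}^2\,x_{2,3}$ and $x^{\mathbf g_2}=x_{1,2}\,x_{2,3}^2$, do not belong to the $\mathbb{K}$-subalgebra of $\overrightarrow{\mathcal{I}}_3$ generated by the invariants $\mathcal{O}(\mathbf g)$ with $\mathbf g$ a simple digraph on $3$ vertices. In particular $\overrightarrow{\mathcal{I}}_3$ is not generated by the invariants $\mathcal{O}(\mathbf g)$ with $\mathbf g$ a simple digraph.
   Context: Let $\mathbb{K}[x_{i,j}]$ be the polynomial ring in $n^2$ variables indexed by the ordered pairs $(i,j)\in\{1,\dots,n\}^2$ (including $i=j$). The symmetric group $\mathfrak{S}_n$ acts on it by $\sigma\cdot x_{i,j}=x_{\sigma(i),\sigma(j)}$, and $\overrightarrow{\mathcal{I}}_n:=\mathbb{K}[x_{i,j}]^{\mathfrak{S}_n}$ is the invariant ring over digraphs (directed graphs, with loops allowed). A multidigraph $\mathbf g$ on $n$ vertices is a family $(g_{i,j})$ of non-negative integers; it is a simple digraph if all $g_{i,j}\in\{0,1\}$. Write $x^{\mathbf g}=\prod x_{i,j}^{g_{i,j}}$ and $\mathcal{O}(\mathbf g)=\sum_{\mathbf h}x^{\mathbf h}$, the sum being over all distinct multidigraphs $\mathbf h$ in the $\mathfrak{S}_n$-orbit of $\mathbf g$. *)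

theory Defs
  imports Complex_Main "HOL.Hull" "HOL-Library.Poly_Mapping" "HOL-Combinatorics.Permutations"
begin

text \<open>
  A multidigraph \<open>g\<close> is identified with its finitely supported family of multiplicities
  \<open>g\<^bsub>i,j\<^esub>\<close>, and polynomials are finitely supported coefficient functions on such
  exponent families.  The types allow arbitrary vertex labels; the number \<open>n\<close> of
  vertices enters through the carriers below.
\<close>

type_synonym multidigraph = "(nat \<times> nat) \<Rightarrow>\<^sub>0 nat"
type_synonym 'k digraph_poly = "multidigraph \<Rightarrow>\<^sub>0 'k"

definition multidigraphs :: "nat \<Rightarrow> multidigraph set" where
  "multidigraphs n = {g. Poly_Mapping.keys g \<subseteq> {1..n} \<times> {1..n}}"

definition simple_digraphs :: "nat \<Rightarrow> multidigraph set" where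
  "simple_digraphs n = {g \<in> multidigraphs n. \<forall>e. Poly_Mapping.lookup g e \<in> {0, 1}}"

definition Const :: "'k::field_char_0 \<Rightarrow> 'k digraph_poly" where
  "Const c = Poly_Mapping.single 0 c"

definition X :: "nat \<Rightarrow> nat \<Rightarrow> 'k::field_char_0 digraph_poly" where
  "X i j = Poly_Mapping.single (Poly_Mapping.single (i, j) 1) 1"

definition monomial :: "multidigraph \<Rightarrow> 'k::field_char_0 digraph_poly" where
  "monomial g = (\<Prod>(i, j)\<in>Poly_Mapping.keys g. X i j ^ Poly_Mapping.lookup g (i, j))"

definition poly_ring :: "nat \<Rightarrow> 'k::field_char_0 digraph_poly set" where
  "poly_ring n = {p. Poly_Mapping.keys p \<subseteq> multidigraphs n}"

text \<open>The substitution \<open>x\<^bsub>i,j\<^esub> \<mapsto> x\<^bsub>\<sigma>(i),\<sigma>(j)\<^esub>\<close>.\<close>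

definition act :: "(nat \<Rightarrow> nat) \<Rightarrow> 'k::field_char_0 digraph_poly \<Rightarrow> 'k digraph_poly" where
  "act \<sigma> p = (\<Sum>g\<in>Poly_Mapping.keys p. Const (Poly_Mapping.lookup p g) *
     (\<Prod>(i, j)\<in>Poly_Mapping.keys g. X (\<sigma> i) (\<sigma> j) ^ Poly_Mapping.lookup g (i, j)))"

definition invariant_ring :: "nat \<Rightarrow> 'k::field_char_0 digraph_poly set" where
  "invariant_ring n = {p \<in> poly_ring n. \<forall>\<sigma>. \<sigma> permutes {1..n} \<longrightarrow> act \<sigma> p = p}"

definition digraph_orbit :: "nat \<Rightarrow> multidigraph \<Rightarrow> multidigraph set" where
  "digraph_orbit n g = {h. \<exists>\<sigma>. \<sigma> permutes {1..n} \<and>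
     (\<forall>i j. Poly_Mapping.lookup h (\<sigma> i, \<sigma> j) = Poly_Mapping.lookup g (i, j))}"

definition orbit_sum :: "nat \<Rightarrow> multidigraph \<Rightarrow> 'k::field_char_0 digraph_poly" where
  "orbit_sum n g = (\<Sum>h\<in>digraph_orbit n g. monomial h)"

definition subalgebra :: "'k::field_char_0 digraph_poly set \<Rightarrow> bool" where
  "subalgebra A \<longleftrightarrow> range Const \<subseteq> A \<and> (\<forall>p\<in>A. \<forall>q\<in>A. p + q \<in> A \<and> p * q \<in> A)"

text \<open>The \<open>K\<close>-subalgebra generated by \<open>B\<close>, i.e. the smallest subalgebra containing \<open>B\<close>.\<close>

definition generated_subalgebra ::
    "'k::field_char_0 digraph_poly set \<Rightarrow> 'k digraph_poly set" where
  "generated_subalgebra B = subalgebra hull B"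

lemma prod_X_power:
  assumes "finite S"
  shows "(\<Prod>e\<in>S. Poly_Mapping.single (Poly_Mapping.single (f e) (1::nat)) (1::'k::field_char_0) ^ m e)
       = Poly_Mapping.single (\<Sum>e\<in>S. Poly_Mapping.single (f e) (m e)) 1"
proof -
  have pow: "Poly_Mapping.single (Poly_Mapping.single a (1::nat)) (1::'k) ^ k
      = Poly_Mapping.single (Poly_Mapping.single a k) 1" for a :: 'b and k
    by (induction k) (simp_all add: mult_single flip: single_add)
  show ?thesis
    using assms by (induction S rule: finite_induct) (simp_all add: pow[unfolded One_nat_def] mult_single)
qed

lemma relabel_sum:
  fixes \<sigma> :: "nat \<Rightarrow> nat" and g h :: multidigraph
  assumes bij: "bij \<sigma>"
    and h: "\<And>i j. Poly_Mapping.lookup h (\<sigma> i, \<sigma> j) = Poly_Mapping.lookup g (i, j)"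
  shows "(\<Sum>e\<in>Poly_Mapping.keys g.
      Poly_Mapping.single (\<sigma> (fst e), \<sigma> (snd e)) (Poly_Mapping.lookup g e)) = h"
proof (rule poly_mapping_eqI)
  fix d :: "nat \<times> nat"
  obtain a b where d: "d = (\<sigma> a, \<sigma> b)"
    using bij_is_surj[OF bij] by (metis surjD surj_pair)
  have inj: "\<sigma> x = \<sigma> y \<longleftrightarrow> x = y" for x y
    using bij_is_inj[OF bij] by (rule inj_eq)
  have "Poly_Mapping.lookup (\<Sum>e\<in>Poly_Mapping.keys g.
      Poly_Mapping.single (\<sigma> (fst e), \<sigma> (snd e)) (Poly_Mapping.lookup g e)) d
    = (\<Sum>e\<in>Poly_Mapping.keys g. if e = (a, b) then Poly_Mapping.lookup g e else 0)"
    unfolding lookup_sum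
    by (intro sum.cong) (auto simp: lookup_single d inj when_def)
  also have "\<dots> = Poly_Mapping.lookup g (a, b)"
    by (simp add: sum.delta in_keys_iff)
  also have "\<dots> = Poly_Mapping.lookup h d"
    by (simp add: d h)
  finally show "Poly_Mapping.lookup (\<Sum>e\<in>Poly_Mapping.keys g.
      Poly_Mapping.single (\<sigma> (fst e), \<sigma> (snd e)) (Poly_Mapping.lookup g e)) d
    = Poly_Mapping.lookup h d" .
qed

lemma prod_X_relabel:
  fixes \<sigma> :: "nat \<Rightarrow> nat"
  assumes "bij \<sigma>"
    and "\<And>i j. Poly_Mapping.lookup h (\<sigma> i, \<sigma> j) = Poly_Mapping.lookup g (i, j)"
  shows "(\<Prod>(i, j)\<in>Poly_Mapping.keys g. X (\<sigma> i) (\<sigma> j) ^ Poly_Mapping.lookup g (i, j))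
       = Poly_Mapping.single h (1::'k::field_char_0)"
  unfolding X_def case_prod_beta
  using prod_X_power[where 'k='k, OF finite_keys[of g],
      of "\<lambda>e. (\<sigma> (fst e), \<sigma> (snd e))" "Poly_Mapping.lookup g"]
    relabel_sum[OF assms]
  by simp

lemma monomial_eq_single: "monomial g = Poly_Mapping.single g (1::'k::field_char_0)"
  unfolding monomial_def using prod_X_relabel[of id g g] by simp

lemma act_superset:
  assumes "finite S" "Poly_Mapping.keys p \<subseteq> S"
  shows "act \<sigma> p = (\<Sum>g\<in>S. Const (Poly_Mapping.lookup p g) *
     (\<Prod>(i, j)\<in>Poly_Mapping.keys g. X (\<sigma> i) (\<sigma> j) ^ Poly_Mapping.lookup g (i, j)))"
  unfolding act_def
  by (rule sum.mono_neutral_left) (use assms in \<open>auto simp: in_keys_iff Const_def\<close>)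

lemma act_add: "act \<sigma> (p + q) = act \<sigma> p + act \<sigma> q"
proof -
  let ?S = "Poly_Mapping.keys p \<union> Poly_Mapping.keys q"
  have "act \<sigma> r = (\<Sum>g\<in>?S. Const (Poly_Mapping.lookup r g) *
     (\<Prod>(i, j)\<in>Poly_Mapping.keys g. X (\<sigma> i) (\<sigma> j) ^ Poly_Mapping.lookup g (i, j)))"
    if "r \<in> {p, q, p + q}" for r
    by (rule act_superset) (use that Poly_Mapping.keys_add[of p q] in auto)
  then show ?thesis
    by (simp add: lookup_add Const_def single_add distrib_right sum.distrib)
qed

lemma act_zero: "act \<sigma> 0 = 0"
  by (simp add: act_def)

lemma act_sum: "act \<sigma> (sum f S) = (\<Sum>s\<in>S. act \<sigma> (f s))"
  by (induction S rule: infinite_finite_induct) (auto simp: act_zero act_add)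

lemma act_single:
  assumes "bij \<sigma>"
    and "\<And>i j. Poly_Mapping.lookup h (\<sigma> i, \<sigma> j) = Poly_Mapping.lookup g (i, j)"
  shows "act \<sigma> (Poly_Mapping.single g c) = Poly_Mapping.single h c"
proof -
  have "act \<sigma> (Poly_Mapping.single g c) = (\<Sum>g'\<in>{g}.
     Const (Poly_Mapping.lookup (Poly_Mapping.single g c) g') *
     (\<Prod>(i, j)\<in>Poly_Mapping.keys g'. X (\<sigma> i) (\<sigma> j) ^ Poly_Mapping.lookup g' (i, j)))"
    by (rule act_superset) auto
  then show ?thesis
    by (simp add: prod_X_relabel[OF assms] Const_def mult_single)
qed

lemma act_X: "act \<sigma> (X i j) = X (\<sigma> i) (\<sigma> j)"
  by (simp add: act_def X_def Const_def mult_single)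

definition relabel :: "(nat \<Rightarrow> nat) \<Rightarrow> multidigraph \<Rightarrow> multidigraph" where
  "relabel \<sigma> g = (\<Sum>e\<in>Poly_Mapping.keys g.
      Poly_Mapping.single (\<sigma> (fst e), \<sigma> (snd e)) (Poly_Mapping.lookup g e))"

lemma lookup_relabel:
  assumes "bij \<sigma>"
  shows "Poly_Mapping.lookup (relabel \<sigma> g) (\<sigma> i, \<sigma> j) = Poly_Mapping.lookup g (i, j)"
proof -
  have inj: "\<sigma> x = \<sigma> y \<longleftrightarrow> x = y" for x y
    using bij_is_inj[OF assms] by (rule inj_eq)
  have "Poly_Mapping.lookup (relabel \<sigma> g) (\<sigma> i, \<sigma> j)
    = (\<Sum>e\<in>Poly_Mapping.keys g. if e = (i, j) then Poly_Mapping.lookup g e else 0)"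
    unfolding lookup_sum relabel_def
    by (intro sum.cong) (auto simp: lookup_single inj when_def)
  then show ?thesis
    by (simp add: sum.delta in_keys_iff)
qed

lemma relabel_eq:
  assumes "bij \<sigma>"
    and "\<And>i j. Poly_Mapping.lookup h (\<sigma> i, \<sigma> j) = Poly_Mapping.lookup g (i, j)"
  shows "relabel \<sigma> g = h"
  unfolding relabel_def by (rule relabel_sum[OF assms])

lemma digraph_orbit_eq_image:
  "digraph_orbit n g = (\<lambda>\<sigma>. relabel \<sigma> g) ` {\<sigma>. \<sigma> permutes {1..n}}"
proof (intro set_eqI iffI)
  fix h assume "h \<in> digraph_orbit n g"
  then obtain \<sigma> where s: "\<sigma> permutes {1..n}"
    "\<And>i j. Poly_Mapping.lookup h (\<sigma> i, \<sigma> j) = Poly_Mapping.lookup g (i, j)"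
    unfolding digraph_orbit_def by blast
  from relabel_eq[OF permutes_bij[OF s(1)] s(2)] s(1)
  show "h \<in> (\<lambda>\<sigma>. relabel \<sigma> g) ` {\<sigma>. \<sigma> permutes {1..n}}" by blast
next
  fix h assume "h \<in> (\<lambda>\<sigma>. relabel \<sigma> g) ` {\<sigma>. \<sigma> permutes {1..n}}"
  then obtain \<sigma> where s: "\<sigma> permutes {1..n}" "h = relabel \<sigma> g" by blast
  show "h \<in> digraph_orbit n g"
    unfolding digraph_orbit_def s(2)
    using s(1) lookup_relabel[OF permutes_bij[OF s(1)]] by blast
qed

lemma finite_digraph_orbit: "finite (digraph_orbit n g)"
  unfolding digraph_orbit_eq_image by (intro finite_imageI finite_permutations) simp

lemma relabel_relabel:
  assumes "bij \<sigma>" "bij \<tau>"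
  shows "relabel \<sigma> (relabel \<tau> g) = relabel (\<sigma> \<circ> \<tau>) g"
proof (rule relabel_eq[symmetric])
  show "bij (\<sigma> \<circ> \<tau>)" using assms by (simp add: bij_comp)
qed (simp add: lookup_relabel assms)

lemma bij_betw_relabel_orbit:
  assumes "\<sigma> permutes {1..n}"
  shows "bij_betw (relabel \<sigma>) (digraph_orbit n g) (digraph_orbit n g)"
proof -
  have b: "bij \<sigma>" using assms by (rule permutes_bij)
  have inj: "inj (relabel \<sigma>)"
  proof (rule injI, rule poly_mapping_eqI)
    fix p q :: multidigraph and e
    assume "relabel \<sigma> p = relabel \<sigma> q"
    then show "Poly_Mapping.lookup p e = Poly_Mapping.lookup q e"
      using lookup_relabel[OF b] by (metis surj_pair)
  qed
  have sub: "relabel \<sigma> ` digraph_orbit n g \<subseteq> digraph_orbit n g"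
  proof
    fix h assume "h \<in> relabel \<sigma> ` digraph_orbit n g"
    then obtain \<tau> where t: "\<tau> permutes {1..n}" "h = relabel \<sigma> (relabel \<tau> g)"
      by (auto simp: digraph_orbit_eq_image)
    then have "h = relabel (\<sigma> \<circ> \<tau>) g"
      using b permutes_bij relabel_relabel by blast
    with t assms show "h \<in> digraph_orbit n g"
      unfolding digraph_orbit_eq_image using permutes_compose by blast
  qed
  have i: "inj_on (relabel \<sigma>) (digraph_orbit n g)"
    using inj by (rule inj_on_subset) simp
  show ?thesis
    using i sub finite_digraph_orbit endo_inj_surj[of "digraph_orbit n g" "relabel \<sigma>"]
    by (auto simp: bij_betw_def)
qed

lemma orbit_sum_invariant:
  assumes g: "g \<in> multidigraphs n"
  shows "orbit_sum n g \<in> (invariant_ring n :: 'k::field_char_0 digraph_poly set)"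
proof -
  let ?O = "orbit_sum n g :: 'k digraph_poly"
  have "h \<in> multidigraphs n" if h: "h \<in> digraph_orbit n g" for h
  proof -
    obtain \<sigma> where s: "\<sigma> permutes {1..n}"
      "\<And>i j. Poly_Mapping.lookup h (\<sigma> i, \<sigma> j) = Poly_Mapping.lookup g (i, j)"
      using h by (auto simp: digraph_orbit_def)
    have "(a, b) \<in> {1..n} \<times> {1..n}" if "(a, b) \<in> Poly_Mapping.keys h" for a b
    proof -
      obtain i j where ij: "a = \<sigma> i" "b = \<sigma> j"
        using permutes_surj[OF s(1)] by (metis surjD)
      then have "(i, j) \<in> Poly_Mapping.keys g"
        using that s(2) by (simp add: in_keys_iff)
      then have "i \<in> {1..n}" "j \<in> {1..n}"
        using g unfolding multidigraphs_def by blast+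
      then show ?thesis
        using ij permutes_in_image[OF s(1)] by blast
    qed
    then show ?thesis unfolding multidigraphs_def by auto
  qed
  then have "?O \<in> poly_ring n"
    unfolding poly_ring_def orbit_sum_def monomial_eq_single
    using keys_sum[of "\<lambda>h. Poly_Mapping.single h (1::'k)" "digraph_orbit n g"] by fastforce
  moreover have "act \<sigma> ?O = ?O" if s: "\<sigma> permutes {1..n}" for \<sigma>
  proof -
    have "act \<sigma> ?O = (\<Sum>h\<in>digraph_orbit n g. Poly_Mapping.single (relabel \<sigma> h) 1)"
      unfolding orbit_sum_def monomial_eq_single act_sum
      by (intro sum.cong refl act_single permutes_bij[OF s] lookup_relabel)
    also have "\<dots> = ?O"
      unfolding orbit_sum_def monomial_eq_single
      by (rule sum.reindex_bij_betw[OF bij_betw_relabel_orbit[OF s]])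
    finally show ?thesis .
  qed
  ultimately show ?thesis unfolding invariant_ring_def by simp
qed

end

(* Setting every variable other than u = x_{1,2} and v = x_{2,3} to zero maps the ring onto K[u, v].
   A simple digraph orbit sum goes to 0, 1, u + v or u v, so the generated subalgebra lands in the
   symmetric polynomials in u and v.  But O(g1) and O(g2) go to u^2 v and u v^2. *)
theory Submission
  imports Defs
begin

text \<open>This is exchange of u and v at the level of exponents. It permutes arcs, and no vertex
  permutation induces it: sending (1, 2) to (2, 3) forces (2, 3) to leave vertex 3.\<close>

definition swap_arcs :: "multidigraph \<Rightarrow> multidigraph" where
  "swap_arcs = Poly_Mapping.map_key (transpose (1, 2) (2, 3))"

lemma lookup_swap_arcs:
  "Poly_Mapping.lookup (swap_arcs g) e = Poly_Mapping.lookup g (transpose (1, 2) (2, 3) e)"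
  unfolding swap_arcs_def by (simp add: map_key.rep_eq)

lemma swap_arcs_add: "swap_arcs (g + h) = swap_arcs g + swap_arcs h"
  by (rule poly_mapping_eqI) (simp add: lookup_swap_arcs lookup_add)

lemma swap_arcs_swap_arcs [simp]: "swap_arcs (swap_arcs g) = g"
  by (rule poly_mapping_eqI) (simp add: lookup_swap_arcs)

lemma bij_swap_arcs: "bij swap_arcs"
  by (rule involuntory_imp_bij) simp

definition path_supported :: "multidigraph set" where
  "path_supported = {g. Poly_Mapping.keys g \<subseteq> {(1, 2), (2, 3)}}"

text \<open>Multiplicities are non-negative, so nothing cancels in a sum: every divisor of a
  monomial in u and v is again one.\<close>

lemma path_supported_add:
  "g + h \<in> path_supported \<longleftrightarrow> g \<in> path_supported \<and> h \<in> path_supported"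
  unfolding path_supported_def by (auto simp: subset_iff in_keys_iff lookup_add)

lemma path_supported_lookup:
  assumes "g \<in> path_supported" "e \<noteq> (1, 2)" "e \<noteq> (2, 3)"
  shows "Poly_Mapping.lookup g e = 0"
  using assms unfolding path_supported_def by (auto simp: in_keys_iff)

text \<open>The preimage of the symmetric polynomials in u and v under the substitution, expressed
  through coefficients so that the homomorphism itself need not be constructed. Coefficients at
  other exponents are unconstrained.\<close>

definition path_symmetric :: "'k::field_char_0 digraph_poly set" where
  "path_symmetric = {p. \<forall>g\<in>path_supported.
     Poly_Mapping.lookup p (swap_arcs g) = Poly_Mapping.lookup p g}"

text \<open>The coefficient at k is a convolution over k = l + m. Both summands inherit path support
  from k, so reindexing the two sums by the bijection \<open>swap_arcs\<close> changes no nonzero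
  term.\<close>

lemma path_symmetric_mult:
  assumes "p \<in> path_symmetric" "q \<in> path_symmetric"
  shows "p * q \<in> path_symmetric"
proof -
  have "Poly_Mapping.lookup (p * q) (swap_arcs k) = Poly_Mapping.lookup (p * q) k"
    if k: "k \<in> path_supported" for k
  proof -
    \<comment> \<open>This holds for every l: the symmetry of q is used only at those m with k = l +
      m, and these are path supported.\<close>
    have inner: "(\<Sum>m. Poly_Mapping.lookup q m when swap_arcs k = swap_arcs l + m)
        = (\<Sum>m. Poly_Mapping.lookup q m when k = l + m)" for l
    proof (rule Sum_any.reindex_cong[OF bij_swap_arcs])
      show "(\<lambda>m. Poly_Mapping.lookup q m when swap_arcs k = swap_arcs l + m) \<circ> swap_arcs
          = (\<lambda>m. Poly_Mapping.lookup q m when k = l + m)"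
      proof
        fix m
        have "swap_arcs k = swap_arcs l + swap_arcs m \<longleftrightarrow> k = l + m"
          using bij_is_inj[OF bij_swap_arcs] by (simp add: inj_eq flip: swap_arcs_add)
        then show "((\<lambda>m. Poly_Mapping.lookup q m when swap_arcs k = swap_arcs l + m) \<circ> swap_arcs) m
          = (Poly_Mapping.lookup q m when k = l + m)"
          using k assms(2) by (auto simp: when_def path_supported_add path_symmetric_def)
      qed
    qed
    show ?thesis
      unfolding times_poly_mapping.rep_eq prod_fun_def
    proof (rule Sum_any.reindex_cong[OF bij_swap_arcs], rule ext)
      fix l
      show "((\<lambda>l. Poly_Mapping.lookup p l *
              (\<Sum>m. Poly_Mapping.lookup q m when swap_arcs k = l + m)) \<circ> swap_arcs) l
          = Poly_Mapping.lookup p l * (\<Sum>m. Poly_Mapping.lookup q m when k = l + m)"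
      \<comment> \<open>If l does not divide k, it may lie outside \<open>path_supported\<close>,
        where p need not be symmetric; the inner sum then vanishes.\<close>
      proof (cases "\<exists>m. k = l + m")
        case True
        then have "Poly_Mapping.lookup p (swap_arcs l) = Poly_Mapping.lookup p l"
          using k assms(1) by (auto simp: path_supported_add path_symmetric_def)
        then show ?thesis by (simp add: inner)
      next
        case False
        then have "(\<Sum>m. Poly_Mapping.lookup q m when k = l + m) = 0"
          by (simp add: when_def)
        then show ?thesis by (simp add: inner)
      qed
    qed
  qed
  then show ?thesis by (simp add: path_symmetric_def)
qed

lemma subalgebra_path_symmetric: "subalgebra path_symmetric"
proof -
  have "swap_arcs g = 0 \<longleftrightarrow> g = 0" for g
    by (metis add_cancel_right_right swap_arcs_add swap_arcs_swap_arcs)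
  then have "Const c \<in> path_symmetric" for c :: 'a
    by (simp add: path_symmetric_def Const_def lookup_single when_def eq_commute[of 0])
  then show ?thesis
    unfolding subalgebra_def
    by (auto intro: path_symmetric_mult) (simp add: path_symmetric_def lookup_add)
qed

lemma lookup_orbit_sum:
  "Poly_Mapping.lookup (orbit_sum n g :: 'k::field_char_0 digraph_poly) h
    = of_bool (h \<in> digraph_orbit n g)"
  using finite_digraph_orbit[of n g]
  by (simp add: orbit_sum_def monomial_eq_single lookup_sum lookup_single when_def sum.delta)

lemma orbit_sum_path_symmetric_iff:
  "(orbit_sum n g :: 'k::field_char_0 digraph_poly) \<in> path_symmetric \<longleftrightarrow>
    (\<forall>h\<in>path_supported. swap_arcs h \<in> digraph_orbit n g \<longleftrightarrow> h \<in> digraph_orbit n g)"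
  by (auto simp: path_symmetric_def lookup_orbit_sum)

lemma relabel_in_digraph_orbit:
  assumes "\<sigma> permutes {1..n}" "h \<in> digraph_orbit n g"
  shows "relabel \<sigma> h \<in> digraph_orbit n g"
  using bij_betw_apply[OF bij_betw_relabel_orbit[OF assms(1)] assms(2)] .

text \<open>With multiplicities 0 and 1, either both arcs have equal multiplicity and the swap fixes
  h, or just one arc is present and a rotation of the vertices moves it to the other
  position.\<close>

lemma swap_arcs_in_simple_orbit:
  assumes g: "g \<in> simple_digraphs 3" and h: "h \<in> digraph_orbit 3 g" "h \<in> path_supported"
  shows "swap_arcs h \<in> digraph_orbit 3 g"
proof -
  have simple: "Poly_Mapping.lookup h e \<in> {0, 1}" for e
  proof -
    obtain \<sigma> where s: "\<sigma> permutes {1..3}"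
      "\<And>i j. Poly_Mapping.lookup h (\<sigma> i, \<sigma> j) = Poly_Mapping.lookup g (i, j)"
      using h(1) by (auto simp: digraph_orbit_def)
    obtain i j where "e = (\<sigma> i, \<sigma> j)"
      using permutes_surj[OF s(1)] by (metis surjD surj_pair)
    then show ?thesis
      using s(2) g by (simp add: simple_digraphs_def)
  qed
  have vanish: "Poly_Mapping.lookup h (i, j) = 0"
    if "(i, j) \<noteq> (1, 2)" "(i, j) \<noteq> (2, 3)" for i j
    using path_supported_lookup[OF h(2)] that by blast
  \<comment> \<open>The 3-cycle 1 to 2 to 3 to 1, which carries the arc (1, 2) to (2, 3).\<close>
  define \<rho> :: "nat \<Rightarrow> nat" where "\<rho> = transpose 1 2 \<circ> transpose 2 3"
  have \<rho>: "\<rho> permutes {1..3}" "\<rho> 1 = 2" "\<rho> 2 = 3"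
    unfolding \<rho>_def by (auto intro!: permutes_compose permutes_swap_id simp: transpose_def)
  consider "Poly_Mapping.lookup h (1, 2) = Poly_Mapping.lookup h (2, 3)"
    | "Poly_Mapping.lookup h (2, 3) = 0" | "Poly_Mapping.lookup h (1, 2) = 0"
    using simple[of "(1, 2)"] simple[of "(2, 3)"] by auto
  then show ?thesis
  proof cases
    case 1
    then have "swap_arcs h = h"
      by (intro poly_mapping_eqI) (simp add: lookup_swap_arcs transpose_def)
    then show ?thesis using h(1) by simp
  next
    case 2
    have "relabel \<rho> h = swap_arcs h"
    proof (rule relabel_eq[OF permutes_bij[OF \<rho>(1)]])
      fix i j
      show "Poly_Mapping.lookup (swap_arcs h) (\<rho> i, \<rho> j) = Poly_Mapping.lookup h (i, j)"
        using 2 vanish[of i j] vanish[of "\<rho> i" "\<rho> j"] \<rho>(2,3) permutes_inj[OF \<rho>(1), THEN inj_eq]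
        by (auto simp: lookup_swap_arcs transpose_def) metis+
    qed
    with relabel_in_digraph_orbit[OF \<rho>(1) h(1)] show ?thesis by simp
  next
    case 3
    \<comment> \<open>Here h lives on (2, 3), so \<rho> takes the swapped digraph back to h; the
      inverse of \<rho> then realises the swap.\<close>
    have "relabel \<rho> (swap_arcs h) = h"
    proof (rule relabel_eq[OF permutes_bij[OF \<rho>(1)]])
      fix i j
      show "Poly_Mapping.lookup h (\<rho> i, \<rho> j) = Poly_Mapping.lookup (swap_arcs h) (i, j)"
        using 3 vanish[of i j] vanish[of "\<rho> i" "\<rho> j"] \<rho>(2,3) permutes_inj[OF \<rho>(1), THEN inj_eq]
        by (auto simp: lookup_swap_arcs transpose_def) metis+
    qed
    then have "relabel (inv \<rho>) h = swap_arcs h"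
      using relabel_relabel[OF bij_imp_bij_inv permutes_bij, OF permutes_bij, OF \<rho>(1) \<rho>(1), of "swap_arcs h"]
        permutes_inv_o[OF \<rho>(1)] relabel_eq[of id]
      by simp
    with relabel_in_digraph_orbit[OF permutes_inv[OF \<rho>(1)] h(1)] show ?thesis by simp
  qed
qed

lemma swap_arcs_path_supported:
  "g \<in> path_supported \<Longrightarrow> swap_arcs g \<in> path_supported"
  unfolding path_supported_def by (auto simp: subset_iff in_keys_iff lookup_swap_arcs transpose_def split: if_splits)

lemma simple_orbit_sum_path_symmetric:
  assumes "g \<in> simple_digraphs 3"
  shows "orbit_sum 3 g \<in> path_symmetric"
  unfolding orbit_sum_path_symmetric_iff
  \<comment> \<open>The converse implication is the same lemma applied to
    \<open>swap_arcs h\<close>, since the swap is an involution.\<close>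
  using swap_arcs_in_simple_orbit[OF assms] swap_arcs_path_supported swap_arcs_swap_arcs
  by metis

text \<open>Distinct positive weights make the two arcs recognisable, so a relabelling that
  exchanges the weights must send each arc to the other. Vertex 2 is the head of one arc and the
  tail of the other, which gives it two different images.\<close>

lemma orbit_sum_not_path_symmetric:
  assumes "a \<noteq> b" "a > 0" "b > 0"
  shows "orbit_sum 3 (Poly_Mapping.single (1, 2) a + Poly_Mapping.single (2, 3) b) \<notin> path_symmetric"
    (is "orbit_sum 3 ?g \<notin> _")
proof
  assume *: "orbit_sum 3 ?g \<in> path_symmetric"
  have "?g \<in> path_supported"
    by (auto simp: path_supported_def in_keys_iff lookup_add lookup_single when_def split: if_splits)
  moreover have "?g \<in> digraph_orbit 3 ?g"
    unfolding digraph_orbit_def by (auto intro!: exI[of _ id] permutes_id)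
  ultimately have "swap_arcs ?g \<in> digraph_orbit 3 ?g"
    using * unfolding orbit_sum_path_symmetric_iff by blast
  then obtain \<sigma> where s: "\<And>i j. Poly_Mapping.lookup (swap_arcs ?g) (\<sigma> i, \<sigma> j)
      = Poly_Mapping.lookup ?g (i, j)"
    unfolding digraph_orbit_def by blast
  have "\<sigma> 2 = 3" "\<sigma> 2 = 1"
    using s[of 1 2] s[of 2 3] assms
    by (auto simp: lookup_swap_arcs lookup_add lookup_single when_def transpose_def split: if_splits)
  then show False by simp
qed

theorem mainTheorem10:
  fixes g1 g2 :: multidigraph
    and A :: "'k::field_char_0 digraph_poly set"
  assumes "(monomial g1 :: 'k digraph_poly) = X 1 2 ^ 2 * X 2 3"
    and "(monomial g2 :: 'k digraph_poly) = X 1 2 * X 2 3 ^ 2"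
    and "A = generated_subalgebra {orbit_sum 3 g | g. g \<in> simple_digraphs 3}"
  shows "orbit_sum 3 g1 \<notin> A \<and> orbit_sum 3 g2 \<notin> A \<and> A \<noteq> invariant_ring 3"
proof -
  have sub: "A \<subseteq> path_symmetric"
    unfolding assms(3) generated_subalgebra_def
    by (rule hull_minimal) (auto simp: simple_orbit_sum_path_symmetric subalgebra_path_symmetric)
  \<comment> \<open>The hypotheses fix g1 and g2 only through their monomials; an exponent is
    recovered from its monomial because 1 is nonzero in the field.\<close>
  have single_cong: "g = h"
    if "Poly_Mapping.single g (1::'k) = Poly_Mapping.single h 1" for g h :: multidigraph
    using that by (metis lookup_single_eq lookup_single_not_eq zero_neq_one)
  have "X 1 2 ^ 2 * X 2 3 =
      (Poly_Mapping.single (Poly_Mapping.single (1, 2) 2 + Poly_Mapping.single (2, 3) 1) 1 :: 'k digraph_poly)"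
    by (simp add: X_def power2_eq_square mult_single numeral_2_eq_2 flip: single_add)
  then have g1: "g1 = Poly_Mapping.single (1, 2) 2 + Poly_Mapping.single (2, 3) 1"
    using assms(1) by (intro single_cong) (simp add: monomial_eq_single)
  have "X 1 2 * X 2 3 ^ 2 =
      (Poly_Mapping.single (Poly_Mapping.single (1, 2) 1 + Poly_Mapping.single (2, 3) 2) 1 :: 'k digraph_poly)"
    by (simp add: X_def power2_eq_square mult_single numeral_2_eq_2 flip: single_add)
  then have g2: "g2 = Poly_Mapping.single (1, 2) 1 + Poly_Mapping.single (2, 3) 2"
    using assms(2) by (intro single_cong) (simp add: monomial_eq_single)
  have "orbit_sum 3 g1 \<notin> A" "orbit_sum 3 g2 \<notin> A"
    using sub orbit_sum_not_path_symmetric[of 2 1] orbit_sum_not_path_symmetric[of 1 2]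
    unfolding g1 g2 by auto
  \<comment> \<open>\<open>orbit_sum 3 g1\<close> is then an invariant outside A, which separates A
    from the invariant ring.\<close>
  moreover have "g1 \<in> multidigraphs 3"
    by (auto simp: g1 multidigraphs_def in_keys_iff lookup_add lookup_single when_def split: if_splits)
  ultimately show ?thesis using orbit_sum_invariant[of g1 3] by blast
qed

end
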